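(* Let $a,b$ be coprime positive integers. Then $$ V_{1,1}(a,b)=\sum_{k=1}^{b-1}k\left[\frac{ak}{b}\right]=\sum_{j=1}^{b-1}\frac{C_{S_{a,b}}(\epsilon_b^j)}{\epsilon_b^{-ja}-1}+\frac{(a-1)(b-1)^2}{4}. $$
   Context: For coprime positive integers $a,b$, $S_{a,b}=\{xa+yb: x,y\in\mathbb Z_{\ge 0}\}$ is the numerical semigroup generated by $a$ and $b$, $C_{S_{a,b}}:=\mathbb Z_{\ge 0}\setminus S_{a,b}$ (a finite set), and $C_{S_{a,b}}(q):=\sum_{k\in C_{S_{a,b}}}q^k$. $\epsilon_b:=e^{2\pi i/b}$ with $i=\sqrt{-1}$, and $[x]$ is the integer part (floor) of $x$. The Voronoi sums are $V_{m,n}(a,b):=\sum_{k=1}^{b-1}k^m\left[\frac{ak}{b}\right]^n$. *)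

theory Defs
  imports "HOL-Analysis.Analysis"
begin

definition num_semigroup :: "nat \<Rightarrow> nat \<Rightarrow> nat set" where
  "num_semigroup a b = {x * a + y * b | x y. True}"

definition gaps :: "nat set \<Rightarrow> nat set" where
  "gaps S = UNIV - S"

text \<open>
  The generating polynomial of the gaps, as a function on the complex plane.
  It is meaningful only if the set of gaps is finite (otherwise \<open>sum\<close> returns 0);
  this is lemma \<open>finite_gaps_num_semigroup\<close> below.
\<close>

definition gap_poly :: "nat set \<Rightarrow> complex \<Rightarrow> complex" where
  "gap_poly S q = (\<Sum>k\<in>gaps S. q ^ k)"

definition root_eps :: "nat \<Rightarrow> complex" where
  "root_eps b = exp (2 * complex_of_real pi * \<i> / of_nat b)"

definition voronoi_sum :: "nat \<Rightarrow> nat \<Rightarrow> nat \<Rightarrow> nat \<Rightarrow> int" where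
  "voronoi_sum m n a b =
     (\<Sum>k=1..b-1. int k ^ m * \<lfloor>real (a * k) / real b\<rfloor> ^ n)"

lemma finite_gaps_num_semigroup:
  assumes "a > 0" "b > 0" "coprime a b"
  shows "finite (gaps (num_semigroup a b))"
proof -
  have "n \<in> num_semigroup a b" if n: "n \<ge> a * b" for n
  proof -
    obtain u v where uv: "int a * u + int b * v = 1"
      using assms(3) bezout_int[of "int a" "int b"]
      by (metis coprime_imp_gcd_eq_1 gcd_int_int_eq mult.commute of_nat_1)
    define x where "x = (int n * u) mod int b"
    define y where "y = int n * v + int a * ((int n * u) div int b)"
    have "x = int n * u - int b * ((int n * u) div int b)"
      unfolding x_def by (simp add: minus_mult_div_eq_mod)
    then have "x * int a + y * int b = int n * (int a * u + int b * v)"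
      unfolding y_def by algebra
    then have eq: "x * int a + y * int b = int n" using uv by simp
    have x: "0 \<le> x" "x < int b" using assms(2) by (auto simp: x_def)
    have "x * int a < int b * int a" using x assms(1) by simp
    moreover have "int b * int a \<le> int n" using n by (metis mult.commute of_nat_le_iff of_nat_mult)
    ultimately have "y * int b > 0" using eq by linarith
    then have y: "y \<ge> 0" using assms(2) by (simp add: zero_less_mult_iff)
    have "int n = int (nat x * a + nat y * b)" using eq x y by simp
    then have "n = nat x * a + nat y * b" by linarith
    then show ?thesis unfolding num_semigroup_def by blast
  qed
  then have "gaps (num_semigroup a b) \<subseteq> {..<a * b}"
    unfolding gaps_def by (metis DiffD2 lessThan_iff not_le subsetI)
  then show ?thesis using finite_subset by blast
qed

end

theory Submission
  imports Defs "HOL-Number_Theory.Cong"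
begin

text \<open>
  The gaps congruent to \<open>a r\<close> modulo \<open>b\<close>, for \<open>0 \<le> r < b\<close>, are the nonnegative numbers
  \<open>a r - b, a r - 2 b, \<dots>\<close>, because \<open>a r\<close> is the least element of the semigroup in its
  residue class. There are \<open>\<lfloor>a r / b\<rfloor>\<close> of them, so at every \<open>b\<close>-th root of unity \<open>q\<close> the gap
  polynomial takes the value \<open>\<Sum>r<b. \<lfloor>a r / b\<rfloor> q\<^bsup>a r\<^esup>\<close> (\<open>gap_poly_at_root_of_unity\<close>).

  Substitute this and exchange the sums. With the primitive \<open>b\<close>-th root of unity
  \<open>\<eta> = \<epsilon>\<^bsup>a\<^esup>\<close>, the coefficient of \<open>\<lfloor>a r / b\<rfloor>\<close> becomes
  \<open>\<Sum>j=1..b-1. \<eta>\<^bsup>j r\<^esup> / (\<eta>\<^bsup>-j\<^esup> - 1)\<close>, a finite Fourier series of the sawtooth function, equal to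
  \<open>r - (b - 1) / 2\<close> (\<open>sawtooth_fourier\<close>). The part \<open>r\<close> gives the Voronoi sum, and the constant part
  gives the correction term by the classical evaluation
  \<open>\<Sum>r<b. \<lfloor>a r / b\<rfloor> = (a - 1) (b - 1) / 2\<close> (\<open>sum_div_coprime\<close>).
\<close>

section \<open>The gap polynomial at roots of unity\<close>

lemma ex_residue_multiple:
  fixes a b k :: nat
  assumes "b > 0" "coprime a b"
  shows "\<exists>r<b. [a * r = k] (mod b)"
proof -
  obtain x where x: "[a * x = 1] (mod b)"
    using cong_solve_coprime_nat[OF assms(2)] by auto
  have "[a * (x * k mod b) = a * (x * k)] (mod b)"
    by (simp add: cong_def mod_mult_right_eq)
  also have "[a * (x * k) = k] (mod b)"
    using cong_scalar_right[OF x, of k] by (simp add: mult.assoc)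
  finally show ?thesis using assms(1) by (intro exI[of _ "x * k mod b"]) simp
qed

text \<open>
  For \<open>r < b\<close>, no \<open>a r - b m\<close> with \<open>m \<ge> 1\<close> is of the form \<open>x a + y b\<close>: otherwise \<open>a (r - x) = b (m + y) > 0\<close>, and
  the coprime \<open>b\<close> would divide \<open>r - x\<close>, which lies strictly between \<open>0\<close> and \<open>b\<close>.
\<close>

lemma gaps_num_semigroup_eq:
  fixes a b :: nat
  assumes "b > 0" "coprime a b"
  shows "gaps (num_semigroup a b) =
           (\<lambda>(r, m). a * r - b * m) ` (SIGMA r:{..<b}. {1..a * r div b})"
    (is "_ = ?f ` ?A")
proof (intro equalityI subsetI)
  fix k assume k: "k \<in> gaps (num_semigroup a b)"
  obtain r where r: "r < b" "[a * r = k] (mod b)"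
    using ex_residue_multiple[OF assms] by blast
  have lt: "k < a * r"
  proof (rule ccontr)
    assume "\<not> k < a * r"
    then obtain y where "k = a * r + y * b"
      using r(2) by (metis cong_le_nat cong_sym not_less add.commute)
    then have "k = r * a + y * b" by simp
    then have "k \<in> num_semigroup a b"
      unfolding num_semigroup_def by blast
    with k show False by (simp add: gaps_def)
  qed
  then obtain m where m: "a * r = m * b + k"
    using r(2) by (metis cong_le_nat less_imp_le)
  have "m \<ge> 1" using lt m by (cases m) auto
  moreover have "m \<le> a * r div b" using m assms(1) by simp
  ultimately show "k \<in> ?f ` ?A"
    using r(1) m by (intro image_eqI[of _ _ "(r, m)"]) (auto simp: mult.commute)
next
  fix k assume "k \<in> ?f ` ?A"
  then obtain r m where rm: "r < b" "m \<ge> 1" "m \<le> a * r div b" "k = a * r - b * m" by auto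
  have "b * m \<le> a * r"
    using rm(3) by (metis mult_le_mono2 times_div_less_eq_dividend le_trans)
  then have k: "a * r = k + b * m" using rm(4) by simp
  have "k \<notin> num_semigroup a b"
  proof
    assume "k \<in> num_semigroup a b"
    then obtain x y where "k = x * a + y * b" by (auto simp: num_semigroup_def)
    then have eq: "a * r = a * x + b * (y + m)" using k by (simp add: algebra_simps)
    then have "b * (y + m) = a * (r - x)" by (simp add: diff_mult_distrib2)
    then have "b dvd a * (r - x)" by (metis dvd_triv_left)
    then have "b dvd r - x"
      using assms(2) by (simp add: coprime_commute coprime_dvd_mult_right_iff)
    moreover have "b * (y + m) > 0" using assms(1) rm(2) by simp
    then have "a * x < a * r" using eq by linarith
    then have "r - x > 0" by simp
    ultimately show False using rm(1) by (auto dest: dvd_imp_le)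
  qed
  then show "k \<in> gaps (num_semigroup a b)" by (simp add: gaps_def)
qed

lemma inj_on_gap_parametrization:
  fixes a b :: nat
  assumes "b > 0" "coprime a b"
  shows "inj_on (\<lambda>(r, m). a * r - b * m) (SIGMA r:{..<b}. {1..a * r div b})"
proof (rule inj_onI, clarsimp)
  fix r m r' m'
  assume r: "r < b" "r' < b" and m: "m \<le> a * r div b" "m' \<le> a * r' div b"
    and eq: "a * r - b * m = a * r' - b * m'"
  have "b * m \<le> a * r" "b * m' \<le> a * r'"
    using m by (metis mult_le_mono2 times_div_less_eq_dividend le_trans)+
  then have eq': "a * r + b * m' = a * r' + b * m" using eq by linarith
  then have "[a * r = a * r'] (mod b)"
    unfolding cong_def by (metis mod_mult_self2)
  then have "[r = r'] (mod b)"
    using assms(2) cong_mult_lcancel_nat by blast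
  then have "r = r'" using r by (simp add: cong_def)
  with eq' assms(1) show "r = r' \<and> m = m'" by simp
qed

lemma gap_poly_at_root_of_unity:
  fixes a b :: nat and q :: complex
  assumes "b > 0" "coprime a b" and q: "q ^ b = 1"
  shows "gap_poly (num_semigroup a b) q = (\<Sum>r<b. of_nat (a * r div b) * q ^ (a * r))"
proof -
  have "gap_poly (num_semigroup a b) q =
          (\<Sum>(r, m)\<in>(SIGMA r:{..<b}. {1..a * r div b}). q ^ (a * r - b * m))"
    unfolding gap_poly_def gaps_num_semigroup_eq[OF assms(1,2)]
    by (subst sum.reindex[OF inj_on_gap_parametrization[OF assms(1,2)]])
       (simp add: case_prod_unfold o_def)
  also have "\<dots> = (\<Sum>r<b. \<Sum>m=1..a * r div b. q ^ (a * r - b * m))"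
    by (subst sum.Sigma) auto
  also have "\<dots> = (\<Sum>r<b. \<Sum>m=1..a * r div b. q ^ (a * r))"
  proof (intro sum.cong refl)
    fix r m assume "m \<in> {1..a * r div b}"
    then have "b * m \<le> a * r"
      by (metis atLeastAtMost_iff mult_le_mono2 times_div_less_eq_dividend le_trans)
    then have "q ^ (a * r) = q ^ (a * r - b * m) * q ^ (b * m)"
      by (simp flip: power_add)
    then show "q ^ (a * r - b * m) = q ^ (a * r)" by (simp add: power_mult q)
  qed
  also have "\<dots> = (\<Sum>r<b. of_nat (a * r div b) * q ^ (a * r))" by simp
  finally show ?thesis .
qed

section \<open>The finite Fourier series of the sawtooth function\<close>

lemma sum_powers_root_of_unity:
  fixes w :: complex
  assumes "w ^ b = 1" "w \<noteq> 1"
  shows "(\<Sum>j<b. w ^ j) = 0"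
  using geometric_sum[OF assms(2), of b] assms(1) by simp

text \<open>
  Write \<open>T r\<close> for the sum. Consecutive values differ by a power sum over nontrivial roots of
  unity, which is \<open>-1\<close>; hence \<open>T r = T 0 + r\<close>. The constant follows from \<open>\<Sum>r<b. T r = 0\<close>, since the
  powers \<open>\<eta>\<^bsup>j r\<^esup>\<close> with \<open>r < b\<close> add up to zero for every \<open>0 < j < b\<close>.
\<close>

lemma sawtooth_fourier:
  fixes \<eta> :: complex and b r :: nat
  assumes root: "\<eta> ^ b = 1" and prim: "\<And>s. 0 < s \<Longrightarrow> s < b \<Longrightarrow> \<eta> ^ s \<noteq> 1" and r: "r < b"
  shows "(\<Sum>j=1..b-1. \<eta> ^ (j * r) / (inverse (\<eta> ^ j) - 1)) = of_nat r - (of_nat b - 1) / 2"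
proof -
  define T where "T r = (\<Sum>j=1..b-1. \<eta> ^ (j * r) / (inverse (\<eta> ^ j) - 1))" for r
  have nz: "\<eta> \<noteq> 0" using root r by (auto simp: power_0_left)
  have step: "T (Suc r) = T r + 1" if "Suc r < b" for r
  proof -
    have "T r - T (Suc r) = (\<Sum>j=1..b-1. (\<eta> ^ Suc r) ^ j)"
      unfolding T_def sum_subtractf[symmetric]
    proof (intro sum.cong refl)
      fix j assume j: "j \<in> {1..b-1}"
      have ne: "\<eta> ^ j \<noteq> 1" using j by (intro prim) auto
      have e: "\<eta> ^ (j * Suc r) = \<eta> ^ j * \<eta> ^ (j * r)" "(\<eta> ^ Suc r) ^ j = \<eta> ^ (j * Suc r)"
        by (simp add: power_add) (metis power_mult mult.commute)
      have "inverse (\<eta> ^ j) - 1 \<noteq> 0" using ne by simp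
      moreover have "\<eta> ^ (j * r) - \<eta> ^ (j * Suc r)
                      = (\<eta> ^ Suc r) ^ j * (inverse (\<eta> ^ j) - 1)"
        unfolding e right_diff_distrib using nz by simp
      ultimately show "\<eta> ^ (j * r) / (inverse (\<eta> ^ j) - 1) - \<eta> ^ (j * Suc r) / (inverse (\<eta> ^ j) - 1)
              = (\<eta> ^ Suc r) ^ j"
        by (metis diff_divide_distrib nonzero_mult_div_cancel_right)
    qed
    also have "{..<b} = insert 0 {1..b-1}" using r by auto
    then have "(\<Sum>j=1..b-1. (\<eta> ^ Suc r) ^ j) = (\<Sum>j<b. (\<eta> ^ Suc r) ^ j) - 1" by simp
    also have "(\<Sum>j<b. (\<eta> ^ Suc r) ^ j) = 0"
    proof (rule sum_powers_root_of_unity)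
      have "(\<eta> ^ Suc r) ^ b = (\<eta> ^ b) ^ Suc r" by (metis power_mult mult.commute)
      then show "(\<eta> ^ Suc r) ^ b = 1" by (simp add: root)
    qed (use prim that in blast)
    finally show ?thesis by (simp add: algebra_simps)
  qed
  have lin: "T r = T 0 + of_nat r" if "r < b" for r
    using that by (induction r) (auto simp: step)
  have "(\<Sum>r<b. T r) = (\<Sum>j=1..b-1. (\<Sum>r<b. (\<eta> ^ j) ^ r) / (inverse (\<eta> ^ j) - 1))"
    unfolding T_def sum_divide_distrib by (subst sum.swap) (simp add: power_mult)
  also have "\<dots> = 0"
  proof (intro sum.neutral ballI)
    fix j assume j: "j \<in> {1..b-1}"
    have "(\<eta> ^ j) ^ b = 1" by (metis power_mult mult.commute root power_one)
    moreover have "\<eta> ^ j \<noteq> 1" using j by (intro prim) auto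
    ultimately show "(\<Sum>r<b. (\<eta> ^ j) ^ r) / (inverse (\<eta> ^ j) - 1) = 0"
      by (simp add: sum_powers_root_of_unity)
  qed
  finally have "(\<Sum>r<b. T r) = 0" .
  moreover have "(\<Sum>r<b. T r) = (\<Sum>r<b. T 0 + of_nat r)"
    by (rule sum.cong[OF refl], rule lin) simp
  ultimately have zero: "of_nat b * T 0 + (\<Sum>r<b. of_nat r) = 0"
    by (simp add: sum.distrib)
  have gauss: "2 * (\<Sum>r<b. of_nat r :: complex) = of_nat b * (of_nat b - 1)"
    by (induction b) (auto simp: algebra_simps)
  have "of_nat b * (2 * T 0 + (of_nat b - 1))
          = 2 * (of_nat b * T 0 + (\<Sum>r<b. of_nat r))"
    unfolding distrib_left gauss by simp
  then have "of_nat b * (2 * T 0 + (of_nat b - 1)) = 0" by (simp only: zero mult_zero_right)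
  then have "2 * T 0 + (of_nat b - 1) = 0" using r by simp
  then have "2 * T 0 = - (of_nat b - 1)" by (simp only: eq_neg_iff_add_eq_0)
  then have "T 0 = - ((of_nat b - 1) / 2)" by (simp add: field_simps)
  then show ?thesis using lin[OF r] by (simp add: T_def)
qed

section \<open>The sum of the integer parts\<close>

text \<open>
  The reflection \<open>r \<mapsto> b - r\<close> pairs the terms with \<open>0 < r < b\<close>: \<open>a r / b\<close> and \<open>a (b - r) / b\<close> are
  not integers and add up to \<open>a\<close>, so their integer parts add up to \<open>a - 1\<close>.
\<close>

lemma sum_div_coprime:
  fixes a b :: nat
  assumes "b > 0" "coprime a b"
  shows "2 * (\<Sum>r<b. int (a * r div b)) = (int a - 1) * (int b - 1)"
proof -
  define S where "S = (\<Sum>r=1..b-1. int (a * r div b))"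
  have "{..<b} = insert 0 {1..b-1}" using assms(1) by auto
  then have S: "(\<Sum>r<b. int (a * r div b)) = S" by (simp add: S_def)
  have "S = (\<Sum>r=1..b-1. int (a * (b - r) div b))"
    unfolding S_def by (rule sum.reindex_bij_witness[of _ "\<lambda>r. b - r" "\<lambda>r. b - r"]) auto
  then have "2 * S = (\<Sum>r=1..b-1. int (a * r div b) + int (a * (b - r) div b))"
    by (simp add: sum.distrib S_def)
  also have "\<dots> = (\<Sum>r=1..b-1. int a - 1)"
  proof (intro sum.cong refl)
    fix r assume "r \<in> {1..b-1}"
    then have r: "0 < r" "r < b" by auto
    have "\<not> b dvd a * r"
      using r assms(2) by (auto simp: coprime_commute coprime_dvd_mult_right_iff dest: dvd_imp_le)
    then have "\<not> int b dvd int a * int r" by (metis of_nat_dvd_iff of_nat_mult)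
    moreover have "int (a * (b - r)) = int a * int b - int a * int r"
      using r by (simp add: of_nat_diff algebra_simps)
    then have "int (a * (b - r) div b) = (- (int a * int r) + int a * int b) div int b"
      by (simp only: zdiv_int) simp
    then have "int (a * (b - r) div b) = int a + (- (int a * int r)) div int b"
      using assms(1) by (simp only: div_mult_self1 of_nat_eq_0_iff neq0_conv)
    ultimately show "int (a * r div b) + int (a * (b - r) div b) = int a - 1"
      using assms(1) by (simp add: zdiv_int zdiv_zminus1_eq_if dvd_eq_mod_eq_0)
  qed
  also have "\<dots> = (int a - 1) * (int b - 1)" using assms(1) by (simp add: of_nat_diff)
  finally show ?thesis by (simp add: S)
qed

section \<open>The Voronoi sum\<close>

lemma root_eps_power: "root_eps b ^ n = exp (2 * of_real pi * \<i> * of_nat n / of_nat b)"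
  by (simp add: root_eps_def mult_ac flip: exp_of_nat_mult)

lemma root_eps_power_eq_1_iff:
  assumes "b > 0"
  shows "root_eps b ^ n = 1 \<longleftrightarrow> b dvd n"
  using complex_root_unity_eq_1[of b n] assms by (simp add: root_eps_power)

theorem mainTheorem5:
  fixes a b :: nat
  assumes "a > 0" and "b > 0" and "coprime a b"
  shows "voronoi_sum 1 1 a b = (\<Sum>k=1..b-1. int k * \<lfloor>real (a * k) / real b\<rfloor>)
    \<and> complex_of_int (\<Sum>k=1..b-1. int k * \<lfloor>real (a * k) / real b\<rfloor>) =
      (\<Sum>j=1..b-1. gap_poly (num_semigroup a b) (root_eps b ^ j)
                    / (root_eps b powi (- (int j * int a)) - 1))
      + (of_nat a - 1) * (of_nat b - 1)\<^sup>2 / 4"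
proof
  show "voronoi_sum 1 1 a b = (\<Sum>k=1..b-1. int k * \<lfloor>real (a * k) / real b\<rfloor>)"
    by (simp add: voronoi_sum_def)
next
  define \<eta> where "\<eta> = root_eps b ^ a"
  define F where "F r = (of_nat (a * r div b) :: complex)" for r
  have root: "\<eta> ^ b = 1"
    using assms(2) by (simp add: \<eta>_def root_eps_power_eq_1_iff flip: power_mult)
  have prim: "\<eta> ^ s \<noteq> 1" if "0 < s" "s < b" for s
    using that assms by (auto simp: \<eta>_def root_eps_power_eq_1_iff coprime_commute
        coprime_dvd_mult_right_iff simp flip: power_mult dest: dvd_imp_le)
  have "2 * (\<Sum>r<b. F r) = of_int (2 * (\<Sum>r<b. int (a * r div b)))"
    by (simp add: F_def)
  also have "\<dots> = (of_nat a - 1) * (of_nat b - 1)"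
    unfolding sum_div_coprime[OF assms(2,3)] by simp
  finally have sumF: "(\<Sum>r<b. F r) = (of_nat a - 1) * (of_nat b - 1) / 2"
    by (simp add: field_simps)
  have "(\<Sum>j=1..b-1. gap_poly (num_semigroup a b) (root_eps b ^ j)
            / (root_eps b powi (- (int j * int a)) - 1))
        = (\<Sum>j=1..b-1. \<Sum>r<b. F r * (\<eta> ^ (j * r) / (inverse (\<eta> ^ j) - 1)))"
  proof (intro sum.cong refl)
    fix j
    have "(root_eps b ^ j) ^ b = 1"
      using assms(2) by (simp add: root_eps_power_eq_1_iff flip: power_mult)
    moreover have "root_eps b powi (- (int j * int a)) = inverse (\<eta> ^ j)"
      by (simp add: \<eta>_def power_int_minus mult.commute flip: power_mult of_nat_mult)
    moreover have "(root_eps b ^ j) ^ (a * r) = \<eta> ^ (j * r)" for r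
      by (simp add: \<eta>_def mult_ac flip: power_mult)
    ultimately show "gap_poly (num_semigroup a b) (root_eps b ^ j)
            / (root_eps b powi (- (int j * int a)) - 1)
        = (\<Sum>r<b. F r * (\<eta> ^ (j * r) / (inverse (\<eta> ^ j) - 1)))"
      by (simp add: gap_poly_at_root_of_unity assms F_def sum_divide_distrib)
  qed
  also have "\<dots> = (\<Sum>r<b. F r * (\<Sum>j=1..b-1. \<eta> ^ (j * r) / (inverse (\<eta> ^ j) - 1)))"
    by (subst sum.swap) (simp add: sum_distrib_left)
  also have "\<dots> = (\<Sum>r<b. F r * (of_nat r - (of_nat b - 1) / 2))"
    by (intro sum.cong refl) (simp only: sawtooth_fourier[OF root prim] lessThan_iff)
  also have "\<dots> = (\<Sum>r<b. of_nat r * F r) - (\<Sum>r<b. F r) * ((of_nat b - 1) / 2)"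
    unfolding sum_distrib_right sum_subtractf[symmetric]
    by (intro sum.cong refl) (simp add: right_diff_distrib mult.commute)
  also have "(\<Sum>r<b. of_nat r * F r) = (\<Sum>k=1..b-1. of_nat k * F k)"
  proof -
    have "{..<b} = insert 0 {1..b-1}" using assms(2) by auto
    then show ?thesis by simp
  qed
  also have "\<dots> = of_int (\<Sum>k=1..b-1. int k * \<lfloor>real (a * k) / real b\<rfloor>)"
    by (simp add: F_def floor_divide_of_nat_eq del: of_nat_mult)
  finally show "complex_of_int (\<Sum>k=1..b-1. int k * \<lfloor>real (a * k) / real b\<rfloor>) =
      (\<Sum>j=1..b-1. gap_poly (num_semigroup a b) (root_eps b ^ j)
                    / (root_eps b powi (- (int j * int a)) - 1))
      + (of_nat a - 1) * (of_nat b - 1)\<^sup>2 / 4"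
    by (simp add: sumF power2_eq_square)
qed

end
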